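(* Let $2\le s \leq (d+2)/3$. Let the MLR property be satisfied, let $f_0,f_1$ be densities with respect to the Lebesgue measure on $\mathbb{R}$ with c.d.f.s $F_0,F_1$, and set $$\Psi(x)= (s-1)F_{1}(x)+(d-s)(1-F_{0}(x)),\quad x\in\mathbb{R}.$$ Let $t_1$ be the unique solution of $(s-1)F_{1}(x) = (d-s)(1-F_{0}(x))$, and assume that there exists a solution $t_2$, in the common support of the densities, of $(s-1)f_{1}(x) = (d-s)f_{0}(x)$. If $\Psi(t_1)\ge 24$, then $$\inf_{\tilde{\eta}} \sup_{|\eta|_{0} = s} \mathbf{E}_{\eta} |\tilde{\eta} - \eta| \geq \frac{1}{20}\Psi(t_{1}) \geq \frac{1}{20}\Psi(t_{2})= \frac{1}{20} \Psi_{\rm sep}(d-1,s-1).$$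
   Context: Pivotal selection problem: $d>2$ and $1\le s<d$ are integers; $P_0\neq P_1$ are probability measures on $\mathbb{R}$ with densities $f_0,f_1$. For $\eta\in\{0,1\}^d$, under $\mathbf{P}_\eta$ the observations $X_1,\dots,X_d$ are independent, with $X_j\sim P_1$ if $\eta_j=1$ and $X_j\sim P_0$ if $\eta_j=0$; $\mathbf{E}_\eta$ is the corresponding expectation. A selector is any measurable function $\tilde\eta=\tilde\eta(X_1,\dots,X_d,\zeta)$ with values in $\{0,1\}^d$, where $\zeta$ is a randomization variable independent of $(X_1,\dots,X_d)$; $\inf_{\tilde\eta}$ is over all selectors. $|\tilde\eta-\eta|=\sum_{j=1}^d\mathbf{1}(\tilde\eta_j\ne\eta_j)$; $|\eta|_0$ is the number of non-zero components of $\eta$; $\sup_{|\eta|_0=s}$ is over $\eta\in\{0,1\}^d$ with $|\eta|_0=s$. MLR property: the observations take values in a subset of $\mathbb{R}$, the densities $f_0$ and $f_1$ have the same support, and $f_1/f_0$ is a (strictly) increasing function on the support of the densities. For integers $d',s'$ with $1\le s'<d'$, $$\Psi_{\rm sep}(d',s')=s'P_1\big(s'f_1(X) < (d'-s')f_0(X)\big)+(d'-s')P_0\big(s'f_1(X) \ge (d'-s')f_0(X)\big),$$ where $X\sim P_1$ in the first probability and $X\sim P_0$ in the second. *)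

theory Defs
  imports "HOL-Probability.Probability"
begin

definition is_density_of :: "(real \<Rightarrow> real) \<Rightarrow> real measure \<Rightarrow> bool" where
  "is_density_of f P \<longleftrightarrow>
     f \<in> borel_measurable borel \<and> (\<forall>x. 0 \<le> f x) \<and> P = density lborel (\<lambda>x. ennreal (f x))"

text \<open>The support of a density is the set where it does not vanish (not the closure of that set), so
  that the ratio below is only formed where its denominator is positive.\<close>

definition monotone_likelihood_ratio :: "(real \<Rightarrow> real) \<Rightarrow> (real \<Rightarrow> real) \<Rightarrow> bool" where
  "monotone_likelihood_ratio f0 f1 \<longleftrightarrow>
     support_on UNIV f0 = support_on UNIV f1 \<and>
     strict_mono_on (support_on UNIV f0) (\<lambda>x. f1 x / f0 x)"

text \<open>Vectors in \<open>{0,1}\<^sup>d\<close> are extensional functions on \<open>{1..d}\<close>.\<close>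

definition binary_vectors :: "nat \<Rightarrow> (nat \<Rightarrow> nat) set" where
  "binary_vectors d = {1..d} \<rightarrow>\<^sub>E {0, 1}"

definition num_nonzero :: "nat \<Rightarrow> (nat \<Rightarrow> nat) \<Rightarrow> nat" where
  "num_nonzero d \<eta> = card {j \<in> {1..d}. \<eta> j \<noteq> 0}"

definition hamming :: "nat \<Rightarrow> (nat \<Rightarrow> nat) \<Rightarrow> (nat \<Rightarrow> nat) \<Rightarrow> real" where
  "hamming d a b = (\<Sum>j = 1..d. of_bool (a j \<noteq> b j))"

definition obs_law :: "nat \<Rightarrow> real measure \<Rightarrow> real measure \<Rightarrow> (nat \<Rightarrow> nat) \<Rightarrow> (nat \<Rightarrow> real) measure" where
  "obs_law d P0 P1 \<eta> = (\<Pi>\<^sub>M j\<in>{1..d}. if \<eta> j = 1 then P1 else P0)"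

text \<open>\<open>Z\<close> is the law of the randomization variable, which may live in any measurable space. A selector
  is a function of the observation vector and of the randomization variable.\<close>

definition selectors :: "nat \<Rightarrow> 'z measure \<Rightarrow> ((nat \<Rightarrow> real) \<times> 'z \<Rightarrow> nat \<Rightarrow> nat) set" where
  "selectors d Z =
     ((\<Pi>\<^sub>M j\<in>{1..d}. (borel :: real measure)) \<Otimes>\<^sub>M Z)
       \<rightarrow>\<^sub>M (\<Pi>\<^sub>M j\<in>{1..d}. count_space {0, 1})"

text \<open>The product with \<open>Z\<close> expresses that the randomization variable is independent of the
  observations.\<close>

definition hamming_risk ::
  "nat \<Rightarrow> real measure \<Rightarrow> real measure \<Rightarrow> 'z measure \<Rightarrow>
    ((nat \<Rightarrow> real) \<times> 'z \<Rightarrow> nat \<Rightarrow> nat) \<Rightarrow> (nat \<Rightarrow> nat) \<Rightarrow> real" where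
  "hamming_risk d P0 P1 Z \<delta> \<eta> = (\<integral>\<omega>. hamming d (\<delta> \<omega>) \<eta> \<partial>(obs_law d P0 P1 \<eta> \<Otimes>\<^sub>M Z))"

definition minimax_risk ::
  "nat \<Rightarrow> nat \<Rightarrow> real measure \<Rightarrow> real measure \<Rightarrow> 'z measure \<Rightarrow> real" where
  "minimax_risk d s P0 P1 Z =
     (INF \<delta>\<in>selectors d Z. SUP \<eta>\<in>{\<eta> \<in> binary_vectors d. num_nonzero d \<eta> = s}.
        hamming_risk d P0 P1 Z \<delta> \<eta>)"

definition Psi :: "nat \<Rightarrow> nat \<Rightarrow> real measure \<Rightarrow> real measure \<Rightarrow> real \<Rightarrow> real" where
  "Psi d s P0 P1 x = (real s - 1) * cdf P1 x + (real d - real s) * (1 - cdf P0 x)"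

definition Psi_sep ::
  "(real \<Rightarrow> real) \<Rightarrow> (real \<Rightarrow> real) \<Rightarrow> real measure \<Rightarrow> real measure \<Rightarrow> nat \<Rightarrow> nat \<Rightarrow> real" where
  "Psi_sep f0 f1 P0 P1 d' s' =
     real s' * measure P1 {x. real s' * f1 x < (real d' - real s') * f0 x} +
     (real d' - real s') * measure P0 {x. real s' * f1 x \<ge> (real d' - real s') * f0 x}"

end

theory Submission
  imports Defs
begin

text \<open>The supremum over the configurations is bounded below by the average over them. For a fixed
  observation \<open>x\<close>, the posterior inclusion weights are ordered like the \<open>x\<^sub>k\<close> by monotonicity of the
  likelihood ratio, so the set \<open>A = {k. t < x\<^sub>k}\<close> consists of the most likely signals. Hence a selected
  set \<open>D\<close> contains at least as much null weight as \<open>A\<close> if it is at least as large as \<open>A\<close>, and misses at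
  least as much signal weight as \<open>A\<close> otherwise. In either case its posterior loss is at least that of
  the smaller of the two error counts of \<open>A\<close>. Both counts are sums of independent indicators; for
  \<open>t = t\<^sub>1\<close> their means are at least \<open>m = \<Psi>(t\<^sub>1)/2\<close> and at most \<open>2m\<close>, and since variances do not exceed
  means, the expected minimum is at least \<open>m/2 - 3/2\<close>, which is at least \<open>m/10\<close> for \<open>m \<ge> 12\<close>.\<close>

section \<open>Posterior weights of configurations\<close>

text \<open>The part common to \<open>A\<close> and \<open>D\<close> cancels, \<open>A - D\<close>
  is no larger than \<open>D - A\<close>, and every weight on \<open>A - D\<close> is at most every
  weight on \<open>D - A\<close>. Nonnegativity makes additional elements of \<open>D - A\<close>
  harmless.\<close>

lemma sum_le_sum_of_card_le:
  fixes u :: "'a \<Rightarrow> real"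
  assumes "finite I" "A \<subseteq> I" "D \<subseteq> I" "card A \<le> card D"
    and nonneg: "\<And>i. i \<in> I \<Longrightarrow> 0 \<le> u i"
    and le: "\<And>i j. i \<in> A \<Longrightarrow> j \<in> I - A \<Longrightarrow> u i \<le> u j"
  shows "sum u A \<le> sum u D"
proof -
  have fin: "finite A" "finite D" using assms finite_subset by auto
  have card: "card (A - D) \<le> card (D - A)"
    using fin \<open>card A \<le> card D\<close> by (metis card_le_sym_Diff)
  have "sum u (A - D) \<le> sum u (D - A)"
  proof (cases "A - D = {}")
    case True
    have "0 \<le> sum u (D - A)" by (intro sum_nonneg) (use assms in auto)
    then show ?thesis using True by (metis sum.empty)
  next
    case False
    \<comment> \<open>The value \<open>c\<close> separates the two differences: it is attained at
      some \<open>i\<close> in \<open>A - D\<close>, so it bounds the weights of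
      \<open>A - D\<close> from above and those of \<open>D - A\<close> from below.\<close>
    define c where "c = Max (u ` (A - D))"
    have "c \<in> u ` (A - D)" unfolding c_def using False fin by (intro Max_in) auto
    then obtain i where i: "i \<in> A - D" "c = u i" by auto
    have "sum u (A - D) \<le> of_nat (card (A - D)) * c"
      by (rule sum_bounded_above) (use fin in \<open>auto simp: c_def\<close>)
    also have "\<dots> \<le> of_nat (card (D - A)) * c"
      using card i nonneg \<open>A \<subseteq> I\<close> by (intro mult_right_mono) auto
    also have "\<dots> \<le> sum u (D - A)"
      by (rule sum_bounded_below) (use i le \<open>D \<subseteq> I\<close> in auto)
    finally show ?thesis .
  qed
  then show ?thesis
    using sum.Int_Diff[of A u D] sum.Int_Diff[of D u A] fin by (simp add: Int_commute)
qed

text \<open>Cross-multiplication extends monotonicity of the ratio to all real points: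
  \<open>f0\<close> and \<open>f1\<close> vanish together, so if \<open>x\<close> or
  \<open>y\<close> lies off the support, both sides are 0.\<close>

lemma monotone_likelihood_ratio_cross:
  assumes mlr: "monotone_likelihood_ratio f0 f1" and nonneg: "\<And>x. 0 \<le> f0 x" "\<And>x. 0 \<le> f1 x"
    and "x < y"
  shows "f1 x * f0 y \<le> f1 y * f0 x"
proof (cases "f0 x \<noteq> 0 \<and> f0 y \<noteq> 0")
  case True
  then have "f1 x / f0 x < f1 y / f0 y"
    using mlr \<open>x < y\<close> unfolding monotone_likelihood_ratio_def
    by (metis (mono_tags, lifting) UNIV_I in_support_on strict_mono_onD)
  moreover have "0 < f0 x" "0 < f0 y" using True nonneg by (simp_all add: order_less_le)
  ultimately show ?thesis by (simp add: field_simps)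
next
  case False
  have "f0 z = 0 \<longleftrightarrow> f1 z = 0" for z
    using mlr by (auto simp: monotone_likelihood_ratio_def support_on_def)
  with False show ?thesis by (metis mult_zero_left mult_zero_right order_refl)
qed

section \<open>Configurations with \<open>s\<close> ones and their exchange symmetry\<close>

definition configurations :: "nat \<Rightarrow> nat \<Rightarrow> (nat \<Rightarrow> nat) set" where
  "configurations d s = {\<eta> \<in> binary_vectors d. num_nonzero d \<eta> = s}"

lemma binary_vectors_cases: "\<eta> \<in> binary_vectors d \<Longrightarrow> k \<in> {1..d} \<Longrightarrow> \<eta> k = 0 \<or> \<eta> k = 1"
  by (auto simp: binary_vectors_def PiE_iff)

lemma configurations_binary: "\<eta> \<in> configurations d s \<Longrightarrow> \<eta> \<in> binary_vectors d"
  by (simp add: configurations_def)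

lemma finite_configurations: "finite (configurations d s)"
  unfolding configurations_def binary_vectors_def
  by (intro finite_Collect_conjI disjI1) (simp add: finite_PiE)

lemma configurations_nonempty:
  assumes "s \<le> d" shows "configurations d s \<noteq> {}"
proof -
  let ?\<eta> = "\<lambda>k\<in>{1..d}. of_bool (k \<le> s) :: nat"
  have "{k \<in> {1..d}. ?\<eta> k \<noteq> 0} = {1..s}" using assms by auto
  then have "?\<eta> \<in> configurations d s"
    by (auto simp: configurations_def binary_vectors_def num_nonzero_def)
  then show ?thesis by blast
qed

lemma card_signals: "\<eta> \<in> configurations d s \<Longrightarrow> card {k \<in> {1..d}. \<eta> k = 1} = s"
proof -
  assume \<eta>: "\<eta> \<in> configurations d s"
  then have "{k \<in> {1..d}. \<eta> k = 1} = {k \<in> {1..d}. \<eta> k \<noteq> 0}"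
    using binary_vectors_cases[OF configurations_binary[OF \<eta>]] by force
  then show ?thesis using \<eta> by (simp add: configurations_def num_nonzero_def)
qed

text \<open>This is the invariance of the uniform prior under exchange of two coordinates. A
  transposition of points of \<open>{1..d}\<close> also fixes every index outside, so the vector
  stays extensional.\<close>

lemma configurations_transpose:
  assumes "\<eta> \<in> configurations d s" "i \<in> {1..d}" "j \<in> {1..d}"
  shows "\<eta> \<circ> Transposition.transpose i j \<in> configurations d s"
proof -
  let ?\<tau> = "Transposition.transpose i j"
  have perm: "?\<tau> k \<in> {1..d} \<longleftrightarrow> k \<in> {1..d}" for k
    using assms by (simp add: Transposition.transpose_def)
  have "{k \<in> {1..d}. (\<eta> \<circ> ?\<tau>) k \<noteq> 0} = ?\<tau> ` {k \<in> {1..d}. \<eta> k \<noteq> 0}"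
  proof (intro set_eqI iffI)
    fix k assume "k \<in> {k \<in> {1..d}. (\<eta> \<circ> ?\<tau>) k \<noteq> 0}"
    then have "?\<tau> k \<in> {k \<in> {1..d}. \<eta> k \<noteq> 0}" using perm[of k] by simp
    then show "k \<in> ?\<tau> ` {k \<in> {1..d}. \<eta> k \<noteq> 0}" by (metis image_eqI transpose_involutory)
  next
    fix k assume "k \<in> ?\<tau> ` {k \<in> {1..d}. \<eta> k \<noteq> 0}"
    then obtain l where "k = ?\<tau> l" "l \<in> {1..d}" "\<eta> l \<noteq> 0" by auto
    then show "k \<in> {k \<in> {1..d}. (\<eta> \<circ> ?\<tau>) k \<noteq> 0}" using perm[of l] by simp
  qed
  then have "num_nonzero d (\<eta> \<circ> ?\<tau>) = num_nonzero d \<eta>"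
    unfolding num_nonzero_def by (simp add: card_image)
  moreover have "\<eta> \<circ> ?\<tau> \<in> binary_vectors d"
    unfolding binary_vectors_def
  proof (rule PiE_I)
    fix k assume "k \<in> {1..d}"
    then have "?\<tau> k \<in> {1..d}" using perm by blast
    then show "(\<eta> \<circ> ?\<tau>) k \<in> {0, 1}"
      using binary_vectors_cases[OF configurations_binary[OF assms(1)]] by auto
  next
    fix k assume "k \<notin> {1..d}"
    then have "?\<tau> k \<notin> {1..d}" using perm by blast
    then show "(\<eta> \<circ> ?\<tau>) k = undefined"
      using configurations_binary[OF assms(1)] by (auto simp: binary_vectors_def PiE_iff extensional_def)
  qed
  ultimately show ?thesis using assms(1) by (simp add: configurations_def)
qed

text \<open>At fixed \<open>x\<close> this is, as a function of \<open>\<eta>\<close>, the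
  unnormalised posterior weight under the uniform prior on the configurations.\<close>

definition likelihood ::
    "nat \<Rightarrow> (real \<Rightarrow> real) \<Rightarrow> (real \<Rightarrow> real) \<Rightarrow> (nat \<Rightarrow> nat) \<Rightarrow> (nat \<Rightarrow> real) \<Rightarrow> real" where
  "likelihood d f0 f1 \<eta> x = (\<Prod>k\<in>{1..d}. if \<eta> k = 1 then f1 (x k) else f0 (x k))"

lemma likelihood_nonneg:
  "(\<And>x. 0 \<le> f0 x) \<Longrightarrow> (\<And>x. 0 \<le> f1 x) \<Longrightarrow> 0 \<le> likelihood d f0 f1 \<eta> x"
  unfolding likelihood_def by (intro prod_nonneg) auto

text \<open>Only the factors at \<open>i\<close> and \<open>j\<close> change:
  \<open>f1 (x i) * f0 (x j)\<close> becomes \<open>f0 (x i) * f1 (x j)\<close>, and the remaining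
  factors form a common nonnegative product.\<close>

lemma likelihood_transpose_le:
  assumes nonneg: "\<And>x. 0 \<le> f0 x" "\<And>x. 0 \<le> f1 x"
    and cross: "f1 (x j) * f0 (x i) \<le> f1 (x i) * f0 (x j)"
    and ij: "i \<in> {1..d}" "j \<in> {1..d}" and \<eta>: "\<eta> i = 1" "\<eta> j \<noteq> 1"
  shows "likelihood d f0 f1 (\<eta> \<circ> Transposition.transpose i j) x \<le> likelihood d f0 f1 \<eta> x"
proof -
  let ?\<tau> = "Transposition.transpose i j"
  have "i \<noteq> j" using \<eta> by auto
  have split: "prod g {1..d} = g i * g j * prod g ({1..d} - {i} - {j})" for g :: "nat \<Rightarrow> real"
    using ij \<open>i \<noteq> j\<close> by (simp add: prod.remove[of _ i] prod.remove[of _ j] mult.assoc)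
  have rest: "(\<Prod>k\<in>{1..d} - {i} - {j}. if (\<eta> \<circ> ?\<tau>) k = 1 then f1 (x k) else f0 (x k)) =
      (\<Prod>k\<in>{1..d} - {i} - {j}. if \<eta> k = 1 then f1 (x k) else f0 (x k))"
    by (intro prod.cong) auto
  show ?thesis
    unfolding likelihood_def split rest using \<eta> cross nonneg
    by (intro mult_right_mono prod_nonneg) (auto simp: mult.commute)
qed

text \<open>The transposition of \<open>i\<close> and \<open>j\<close> is an involution of the configurations that reverses the sign
  of \<open>1(\<eta>\<^sub>i = 1) - 1(\<eta>\<^sub>j = 1)\<close>.\<close>
lemma inclusion_weight_mono:
  assumes nonneg: "\<And>x. 0 \<le> f0 x" "\<And>x. 0 \<le> f1 x"
    and cross: "f1 (x j) * f0 (x i) \<le> f1 (x i) * f0 (x j)"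
    and ij: "i \<in> {1..d}" "j \<in> {1..d}"
  shows "(\<Sum>\<eta>\<in>configurations d s. likelihood d f0 f1 \<eta> x * of_bool (\<eta> j = 1)) \<le>
    (\<Sum>\<eta>\<in>configurations d s. likelihood d f0 f1 \<eta> x * of_bool (\<eta> i = 1))"
proof -
  let ?\<tau> = "Transposition.transpose i j" and ?H = "configurations d s"
  let ?w = "\<lambda>\<eta>. likelihood d f0 f1 \<eta> x"
  define g where "g \<eta> = of_bool (\<eta> i = 1) - (of_bool (\<eta> j = 1) :: real)" for \<eta> :: "nat \<Rightarrow> nat"
  have inv: "\<eta> \<circ> ?\<tau> \<circ> ?\<tau> = \<eta>" for \<eta> :: "nat \<Rightarrow> nat" by (auto simp: fun_eq_iff)
  have flip: "g (\<eta> \<circ> ?\<tau>) = - g \<eta>" for \<eta> by (simp add: g_def)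
  have "bij_betw (\<lambda>\<eta>. \<eta> \<circ> ?\<tau>) ?H ?H"
    by (rule bij_betw_byWitness[where f' = "\<lambda>\<eta>. \<eta> \<circ> ?\<tau>"])
       (use configurations_transpose ij inv in auto)
  then have "(\<Sum>\<eta>\<in>?H. ?w \<eta> * g \<eta>) = (\<Sum>\<eta>\<in>?H. ?w (\<eta> \<circ> ?\<tau>) * g (\<eta> \<circ> ?\<tau>))"
    by (intro sum.reindex_bij_betw[symmetric])
  \<comment> \<open>Adding the sum to its reindexed copy leaves terms in which the difference of
    likelihoods has the same sign as \<open>g \<eta>\<close>.\<close>
  then have "2 * (\<Sum>\<eta>\<in>?H. ?w \<eta> * g \<eta>) = (\<Sum>\<eta>\<in>?H. (?w \<eta> - ?w (\<eta> \<circ> ?\<tau>)) * g \<eta>)"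
    by (simp add: flip left_diff_distrib sum_subtractf sum_negf)
  also have "\<dots> \<ge> 0"
  proof (rule sum_nonneg)
    fix \<eta> assume "\<eta> \<in> ?H"
    consider "\<eta> i = 1" "\<eta> j \<noteq> 1" | "\<eta> i \<noteq> 1" "\<eta> j = 1" | "g \<eta> = 0"
      by (cases "\<eta> i = 1"; cases "\<eta> j = 1") (simp_all add: g_def)
    then show "0 \<le> (?w \<eta> - ?w (\<eta> \<circ> ?\<tau>)) * g \<eta>"
    proof cases
      case 1
      then show ?thesis
        using likelihood_transpose_le[OF nonneg cross ij, of \<eta>] by (simp add: g_def)
    next
      \<comment> \<open>Here \<open>\<eta> \<circ> ?\<tau>\<close> has its one at \<open>i\<close>,
        so it takes the role that \<open>\<eta>\<close> has in the first case.\<close>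
      case 2
      then show ?thesis
        using likelihood_transpose_le[OF nonneg cross ij, of "\<eta> \<circ> ?\<tau>"]
        by (simp add: g_def inv)
    qed simp
  qed
  finally show ?thesis
    by (simp add: g_def right_diff_distrib sum_subtractf)
qed

text \<open>The two error counts of the rule that selects the coordinates with \<open>t < x\<^sub>k\<close>.\<close>

definition missed_signals :: "nat \<Rightarrow> real \<Rightarrow> (nat \<Rightarrow> nat) \<Rightarrow> (nat \<Rightarrow> real) \<Rightarrow> real" where
  "missed_signals d t \<eta> x = (\<Sum>k\<in>{k \<in> {1..d}. \<eta> k = 1}. indicator {..t} (x k))"

definition false_signals :: "nat \<Rightarrow> real \<Rightarrow> (nat \<Rightarrow> nat) \<Rightarrow> (nat \<Rightarrow> real) \<Rightarrow> real" where
  "false_signals d t \<eta> x = (\<Sum>k\<in>{k \<in> {1..d}. \<eta> k \<noteq> 1}. indicator {t<..} (x k))"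

text \<open>This is the Bayes inequality at a fixed observation \<open>x\<close>. Since it holds for
  every decision \<open>b\<close>, it can later be applied to the value of a randomised
  selector.\<close>

lemma weighted_hamming_ge:
  assumes mlr: "monotone_likelihood_ratio f0 f1" and nonneg: "\<And>x. 0 \<le> f0 x" "\<And>x. 0 \<le> f1 x"
  shows "(\<Sum>\<eta>\<in>configurations d s. likelihood d f0 f1 \<eta> x * min (missed_signals d t \<eta> x) (false_signals d t \<eta> x))
    \<le> (\<Sum>\<eta>\<in>configurations d s. likelihood d f0 f1 \<eta> x * hamming d b \<eta>)"
proof -
  let ?H = "configurations d s" and ?w = "\<lambda>\<eta>. likelihood d f0 f1 \<eta> x"
  let ?I = "{1..d}"
  define A where "A = {k \<in> ?I. t < x k}"
  define D where "D = {k \<in> ?I. b k = 1}"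
  define p where "p k = (\<Sum>\<eta>\<in>?H. ?w \<eta> * of_bool (\<eta> k = 1))" for k
  define q where "q k = (\<Sum>\<eta>\<in>?H. ?w \<eta> * of_bool (\<eta> k \<noteq> 1))" for k
  have w: "0 \<le> ?w \<eta>" for \<eta> using likelihood_nonneg nonneg by blast
  \<comment> \<open>The total weight does not depend on \<open>k\<close>, so ordering the signal
    weights \<open>p\<close> orders the null weights \<open>q\<close> in reverse.\<close>
  have pq: "p k + q k = (\<Sum>\<eta>\<in>?H. ?w \<eta>)" for k
    unfolding p_def q_def sum.distrib[symmetric] by (intro sum.cong) auto
  have p0: "0 \<le> p k" and q0: "0 \<le> q k" for k
    using w by (auto simp: p_def q_def intro!: sum_nonneg)
  have mono: "p j \<le> p i" if "i \<in> A" "j \<in> ?I - A" for i j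
    unfolding p_def
    by (rule inclusion_weight_mono[OF nonneg monotone_likelihood_ratio_cross[OF mlr nonneg]])
       (use that in \<open>auto simp: A_def\<close>)
  have mono': "q i \<le> q j" if "i \<in> A" "j \<in> ?I - A" for i j
    using mono[OF that] pq[of i] pq[of j] by linarith
  have swap_p: "sum p K = (\<Sum>\<eta>\<in>?H. ?w \<eta> * (\<Sum>k\<in>K. of_bool (\<eta> k = 1)))" for K
    unfolding p_def by (subst sum.swap) (simp add: sum_distrib_left)
  have swap_q: "sum q K = (\<Sum>\<eta>\<in>?H. ?w \<eta> * (\<Sum>k\<in>K. of_bool (\<eta> k \<noteq> 1)))" for K
    unfolding q_def by (subst sum.swap) (simp add: sum_distrib_left)
  have missed: "missed_signals d t \<eta> x = (\<Sum>k\<in>?I - A. of_bool (\<eta> k = 1))" for \<eta>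
    unfolding missed_signals_def by (rule sum.mono_neutral_cong) (auto simp: A_def)
  have false_s: "false_signals d t \<eta> x = (\<Sum>k\<in>A. of_bool (\<eta> k \<noteq> 1))" for \<eta>
    unfolding false_signals_def by (rule sum.mono_neutral_cong) (auto simp: A_def)
  show ?thesis
  proof (cases "card A \<le> card D")
    case True
    have "(\<Sum>\<eta>\<in>?H. ?w \<eta> * min (missed_signals d t \<eta> x) (false_signals d t \<eta> x)) \<le> sum q A"
      unfolding swap_q false_s[symmetric] using w by (intro sum_mono mult_left_mono) auto
    also have "\<dots> \<le> sum q D"
      by (rule sum_le_sum_of_card_le[where I = ?I]) (use True q0 mono' in \<open>auto simp: A_def D_def\<close>)
    also have "\<dots> \<le> (\<Sum>\<eta>\<in>?H. ?w \<eta> * hamming d b \<eta>)"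
      unfolding swap_q
    proof (intro sum_mono mult_left_mono w)
      fix \<eta> :: "nat \<Rightarrow> nat"
      have "(\<Sum>k\<in>D. of_bool (\<eta> k \<noteq> 1)) = (\<Sum>k\<in>?I. if b k = 1 then of_bool (\<eta> k \<noteq> 1) else (0::real))"
        unfolding D_def by (rule sum.inter_filter) simp
      \<comment> \<open>A selected coordinate that is null in \<open>\<eta>\<close> is a
        disagreement between \<open>b\<close> and \<open>\<eta>\<close>.\<close>
      also have "\<dots> \<le> hamming d b \<eta>"
        unfolding hamming_def by (intro sum_mono) auto
      finally show "(\<Sum>k\<in>D. of_bool (\<eta> k \<noteq> 1)) \<le> hamming d b \<eta>" .
    qed
    finally show ?thesis .
  next
    case False
    have sub: "A \<subseteq> ?I" "D \<subseteq> ?I" by (auto simp: A_def D_def)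
    have "(\<Sum>\<eta>\<in>?H. ?w \<eta> * min (missed_signals d t \<eta> x) (false_signals d t \<eta> x)) \<le> sum p (?I - A)"
      unfolding swap_p missed[symmetric] using w by (intro sum_mono mult_left_mono) auto
    \<comment> \<open>Now \<open>D\<close> is smaller than \<open>A\<close>, hence
      \<open>?I - A\<close> is smaller than \<open>?I - D\<close>, and \<open>?I - A\<close> carries
      the lowest signal weights.\<close>
    also have "\<dots> \<le> sum p (?I - D)"
    proof (rule sum_le_sum_of_card_le[where I = ?I])
      show "card (?I - A) \<le> card (?I - D)"
        using False sub by (simp add: card_Diff_subset finite_subset)
    qed (use p0 mono in auto)
    also have "\<dots> \<le> (\<Sum>\<eta>\<in>?H. ?w \<eta> * hamming d b \<eta>)"
      unfolding swap_p
    proof (intro sum_mono mult_left_mono w)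
      fix \<eta> :: "nat \<Rightarrow> nat"
      have "(\<Sum>k\<in>?I - D. of_bool (\<eta> k = 1)) = (\<Sum>k\<in>?I. if b k \<noteq> 1 then of_bool (\<eta> k = 1) else (0::real))"
      proof -
        have "?I - D = {k \<in> ?I. b k \<noteq> 1}" by (auto simp: D_def)
        then show ?thesis by (simp only:) (rule sum.inter_filter, simp)
      qed
      also have "\<dots> \<le> hamming d b \<eta>"
        unfolding hamming_def by (intro sum_mono) auto
      finally show "(\<Sum>k\<in>?I - D. of_bool (\<eta> k = 1)) \<le> hamming d b \<eta>" .
    qed
    finally show ?thesis .
  qed
qed

section \<open>The Bayes lower bound\<close>

text \<open>The variance of a sum of independent indicators is the sum of their variances, and each
  of these is \<open>p * (1 - p)\<close>, at most the mean \<open>p\<close>.\<close>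

lemma (in product_prob_space) integral_centred_count_square:
  assumes fin: "finite I" and J: "J \<subseteq> I" and B: "\<And>i. i \<in> I \<Longrightarrow> B i \<in> sets (M i)"
  defines "g \<equiv> \<lambda>x. \<Sum>i\<in>J. indicator (B i) (x i) - measure (M i) (B i)"
  shows "integrable (PiM I M) (\<lambda>x. (g x)\<^sup>2)"
    and "(\<integral>x. (g x)\<^sup>2 \<partial>PiM I M) \<le> (\<Sum>i\<in>J. measure (M i) (B i))"
proof -
  define p where "p i = measure (M i) (B i)" for i
  define u where "u i y = indicator (B i) y - p i" for i y
  have u_int: "integrable (M i) (u i)" and u_mean: "(\<integral>y. u i y \<partial>M i) = 0"
    and u2_int: "integrable (M i) (\<lambda>y. u i y * u i y)"
    and u2_mean: "(\<integral>y. u i y * u i y \<partial>M i) \<le> p i" if "i \<in> I" for i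
  proof -
    have ind: "integrable (M i) (indicator (B i) :: _ \<Rightarrow> real)"
      using B[OF that] by (simp add: M.emeasure_eq_measure)
    have sp: "B i \<inter> space (M i) = B i" using sets.sets_into_space[OF B[OF that]] by auto
    show "integrable (M i) (u i)" unfolding u_def using ind by simp
    show "(\<integral>y. u i y \<partial>M i) = 0"
      unfolding u_def using ind B[OF that] by (simp add: p_def sp M.prob_space)
    \<comment> \<open>An indicator is its own square, so the centred square is affine in the
      indicator, with mean \<open>p i - p i * p i\<close>.\<close>
    have eq: "u i y * u i y = (1 - 2 * p i) * indicator (B i) y + p i * p i" for y
      by (simp add: u_def indicator_def algebra_simps)
    show "integrable (M i) (\<lambda>y. u i y * u i y)" unfolding eq using ind by simp
    show "(\<integral>y. u i y * u i y \<partial>M i) \<le> p i"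
      unfolding eq using ind B[OF that]
      by (simp add: p_def[symmetric] sp M.prob_space algebra_simps)
  qed
  \<comment> \<open>\<open>F i j k\<close> is the factor at coordinate \<open>k\<close> of the
    product \<open>u i (x i) * u j (x j)\<close>. The diagonal \<open>i = j\<close> is included,
    with the square at \<open>k = i\<close>, so one product formula serves all pairs.\<close>
  define F where "F i j k y = (if k = i then u i y else 1) * (if k = j then u j y else 1)" for i j k y
  have F_int: "integrable (M k) (F i j k)" if "i \<in> I" "j \<in> I" for i j k
    using that u_int u2_int by (cases "k = i"; cases "k = j") (auto simp: F_def[abs_def])
  have prod_F: "(\<Prod>k\<in>I. F i j k (x k)) = u i (x i) * u j (x j)" if "i \<in> I" "j \<in> I" for i j x
    using that fin by (simp add: F_def prod.distrib)
  have cov_int: "integrable (PiM I M) (\<lambda>x. u i (x i) * u j (x j))" if "i \<in> I" "j \<in> I" for i j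
    using product_integrable_prod[OF fin, of "F i j"] F_int[OF that] prod_F[OF that] by simp
  have cov: "(\<integral>x. u i (x i) * u j (x j) \<partial>PiM I M) = (\<Prod>k\<in>I. \<integral>y. F i j k y \<partial>M k)"
    if "i \<in> I" "j \<in> I" for i j
    using product_integral_prod[OF fin, of "F i j"] F_int[OF that] prod_F[OF that] by simp
  have cov_off: "(\<integral>x. u i (x i) * u j (x j) \<partial>PiM I M) = 0" if "i \<in> I" "j \<in> I" "i \<noteq> j" for i j
  proof -
    \<comment> \<open>For distinct \<open>i\<close> and \<open>j\<close> the factor at
      \<open>i\<close> is centred, and one zero factor annihilates the product of integrals.\<close>
    have "(\<integral>y. F i j i y \<partial>M i) = 0" using that u_mean by (simp add: F_def)
    then show ?thesis using cov[OF that(1,2)] fin that(1) by (metis prod_zero)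
  qed
  have cov_diag: "(\<integral>x. u i (x i) * u i (x i) \<partial>PiM I M) \<le> p i" if "i \<in> I" for i
  proof -
    have "(\<integral>y. F i i k y \<partial>M k) = (if k = i then (\<integral>y. u i y * u i y \<partial>M i) else 1)" for k
      by (simp add: F_def M.prob_space)
    then show ?thesis using cov[OF that that] u2_mean[OF that] fin that by simp
  qed
  have g2: "(g x)\<^sup>2 = (\<Sum>i\<in>J. \<Sum>j\<in>J. u i (x i) * u j (x j))" for x
    by (simp add: g_def u_def p_def power2_eq_square sum_product)
  have ints: "integrable (PiM I M) (\<lambda>x. u i (x i) * u j (x j))" if "i \<in> J" "j \<in> J" for i j
    using that J cov_int by auto
  show "integrable (PiM I M) (\<lambda>x. (g x)\<^sup>2)"
    unfolding g2 using ints by simp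
  have "(\<integral>x. (g x)\<^sup>2 \<partial>PiM I M) = (\<Sum>i\<in>J. \<Sum>j\<in>J. \<integral>x. u i (x i) * u j (x j) \<partial>PiM I M)"
    unfolding g2 using ints by simp
  also have "\<dots> = (\<Sum>i\<in>J. \<integral>x. u i (x i) * u i (x i) \<partial>PiM I M)"
  proof (rule sum.cong[OF refl])
    fix i assume "i \<in> J"
    have "finite J" using fin J finite_subset by blast
    then have "(\<Sum>j\<in>J. \<integral>x. u i (x i) * u j (x j) \<partial>PiM I M) =
        (\<Sum>j\<in>{i}. \<integral>x. u i (x i) * u j (x j) \<partial>PiM I M)"
      by (intro sum.mono_neutral_right) (use cov_off \<open>i \<in> J\<close> J in auto)
    then show "(\<Sum>j\<in>J. \<integral>x. u i (x i) * u j (x j) \<partial>PiM I M) =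
        (\<integral>x. u i (x i) * u i (x i) \<partial>PiM I M)" by simp
  qed
  also have "\<dots> \<le> (\<Sum>i\<in>J. p i)"
    by (intro sum_mono cov_diag) (use J in auto)
  finally show "(\<integral>x. (g x)\<^sup>2 \<partial>PiM I M) \<le> (\<Sum>i\<in>J. measure (M i) (B i))"
    by (simp add: p_def)
qed

text \<open>A quadratic minorant of the minimum lets second moments alone control its expectation,
  without any tail estimate.\<close>

lemma min_ge_quadratic:
  fixes a b :: real
  assumes "m \<le> \<mu>" "m \<le> \<nu>"
  shows "m - 3 / 2 - (a - \<mu>)\<^sup>2 / 6 - (b - \<nu>)\<^sup>2 / 6 \<le> min a b"
proof -
  \<comment> \<open>\<open>|v| \<le> v\<^sup>2/(2c) + c/2\<close> with \<open>c = 3\<close>\<close>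
  have quad: "- v - 3 / 2 \<le> v\<^sup>2 / 6" for v :: real
  proof -
    have "0 \<le> (v + 3)\<^sup>2" by simp
    then show ?thesis by (simp add: power2_eq_square algebra_simps)
  qed
  have "0 \<le> (a - \<mu>)\<^sup>2" "0 \<le> (b - \<nu>)\<^sup>2" by simp_all
  then show ?thesis using assms quad[of "a - \<mu>"] quad[of "b - \<nu>"] by linarith
qed

section \<open>Expected minimum of the two error counts\<close>

lemma missed_signals_measurable [measurable]:
  "missed_signals d t \<eta> \<in> borel_measurable (PiM {1..d} (\<lambda>_. borel))"
  unfolding missed_signals_def by measurable

lemma false_signals_measurable [measurable]:
  "false_signals d t \<eta> \<in> borel_measurable (PiM {1..d} (\<lambda>_. borel))"
  unfolding false_signals_def by measurable

lemma missed_signals_bounds: "0 \<le> missed_signals d t \<eta> x" "missed_signals d t \<eta> x \<le> d"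
proof -
  show "0 \<le> missed_signals d t \<eta> x" unfolding missed_signals_def by (intro sum_nonneg) simp
  have "missed_signals d t \<eta> x \<le> (\<Sum>k\<in>{k \<in> {1..d}. \<eta> k = 1}. 1)"
    unfolding missed_signals_def by (intro sum_mono) (simp add: indicator_def)
  also have "\<dots> \<le> (\<Sum>k\<in>{1..d}. 1)" by (rule sum_mono2) auto
  finally show "missed_signals d t \<eta> x \<le> d" by simp
qed

lemma false_signals_nonneg: "0 \<le> false_signals d t \<eta> x"
  unfolding false_signals_def by (intro sum_nonneg) simp

lemma is_density_of_sets: "is_density_of f P \<Longrightarrow> sets P = sets borel"
  by (simp add: is_density_of_def)

lemma sets_obs_law:
  assumes "sets P0 = sets borel" "sets P1 = sets borel"
  shows "sets (obs_law d P0 P1 \<eta>) = sets (PiM {1..d} (\<lambda>_. borel))"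
  unfolding obs_law_def by (rule sets_PiM_cong) (use assms in auto)

lemma prob_space_obs_law:
  assumes "prob_space P0" "prob_space P1"
  shows "prob_space (obs_law d P0 P1 \<eta>)"
  unfolding obs_law_def by (rule prob_space_PiM) (use assms in auto)

text \<open>The counts have means \<open>s * cdf P1 t\<close> and, by the balance equation,
  \<open>(s - 1) * cdf P1 t\<close>. Both variances are at most the means, and the quadratic
  minorant of the minimum is integrated.\<close>

lemma expectation_min_ge:
  assumes P: "prob_space P0" "prob_space P1" "sets P0 = sets borel" "sets P1 = sets borel"
    and \<eta>: "\<eta> \<in> configurations d s" and s: "2 \<le> s" "s \<le> d"
    and balance: "(real s - 1) * cdf P1 t = (real d - real s) * (1 - cdf P0 t)"
  shows "(real s - 1) * cdf P1 t / 2 - 3 / 2 \<le>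
    (\<integral>x. min (missed_signals d t \<eta> x) (false_signals d t \<eta> x) \<partial>obs_law d P0 P1 \<eta>)"
proof -
  interpret P0: prob_space P0 by fact
  interpret P1: prob_space P1 by fact
  define M where "M j = (if \<eta> j = 1 then P1 else P0)" for j :: nat
  interpret M: product_prob_space M "{1..d}"
    by (rule product_prob_spaceI) (use P in \<open>simp add: M_def\<close>)
  define S where "S = {k \<in> {1..d}. \<eta> k = 1}"
  define T where "T = {k \<in> {1..d}. \<eta> k \<noteq> 1}"
  define m where "m = (real s - 1) * cdf P1 t"
  define \<mu> where "\<mu> = real s * cdf P1 t"
  let ?a = "missed_signals d t \<eta>" and ?b = "false_signals d t \<eta>"
  have obs: "obs_law d P0 P1 \<eta> = PiM {1..d} M" by (simp add: obs_law_def M_def[abs_def])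
  have sets_M: "sets (M j) = sets borel" for j using P by (simp add: M_def)
  interpret obs: prob_space "obs_law d P0 P1 \<eta>" by (rule prob_space_obs_law) fact+
  have meas [measurable_cong]: "sets (obs_law d P0 P1 \<eta>) = sets (PiM {1..d} (\<lambda>_. borel))"
    by (rule sets_obs_law) fact+
  have cardS: "card S = s" using card_signals[OF \<eta>] by (simp add: S_def)
  have sub: "S \<subseteq> {1..d}" "T \<subseteq> {1..d}" by (auto simp: S_def T_def)
  have "T = {1..d} - S" by (auto simp: S_def T_def)
  then have cardT: "real (card T) = real d - real s"
    using cardS s card_Diff_subset[of S "{1..d}"] finite_subset[OF sub(1)] sub by simp
  have cdf0: "measure P0 {t<..} = 1 - cdf P0 t"
  proof -
    have "space P0 - {..t} = {t<..}" using sets_eq_imp_space_eq[OF P(3)] by auto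
    then show ?thesis using P0.prob_compl[of "{..t}"] P(3) by (simp add: cdf_def)
  qed
  have "(\<Sum>i\<in>S. measure (M i) {..t}) = (\<Sum>i\<in>S. cdf P1 t)"
    by (intro sum.cong) (auto simp: S_def M_def cdf_def)
  then have sum_a: "(\<Sum>i\<in>S. measure (M i) {..t}) = \<mu>"
    using cardS by (simp add: \<mu>_def)
  have "(\<Sum>i\<in>T. measure (M i) {t<..}) = (\<Sum>i\<in>T. 1 - cdf P0 t)"
    by (intro sum.cong) (auto simp: T_def M_def cdf0)
  then have sum_b: "(\<Sum>i\<in>T. measure (M i) {t<..}) = m"
    using cardT balance by (simp add: m_def)
  have centred_a: "(\<Sum>i\<in>S. indicator {..t} (x i) - measure (M i) {..t}) = ?a x - \<mu>" for x
    unfolding sum_subtractf sum_a by (simp only: missed_signals_def S_def)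
  have centred_b: "(\<Sum>i\<in>T. indicator {t<..} (x i) - measure (M i) {t<..}) = ?b x - m" for x
    unfolding sum_subtractf sum_b by (simp only: false_signals_def T_def)
  have a_int: "integrable (PiM {1..d} M) (\<lambda>x. (?a x - \<mu>)\<^sup>2)"
    and a_var: "(\<integral>x. (?a x - \<mu>)\<^sup>2 \<partial>PiM {1..d} M) \<le> \<mu>"
    using M.integral_centred_count_square[of S "\<lambda>_. {..t}"] sets_M
    unfolding centred_a sum_a using sub by simp_all
  have b_int: "integrable (PiM {1..d} M) (\<lambda>x. (?b x - m)\<^sup>2)"
    and b_var: "(\<integral>x. (?b x - m)\<^sup>2 \<partial>PiM {1..d} M) \<le> m"
    using M.integral_centred_count_square[of T "\<lambda>_. {t<..}"] sets_M
    unfolding centred_b sum_b using sub by simp_all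
  have "0 \<le> cdf P1 t" by (simp add: cdf_def)
  \<comment> \<open>The second bound is \<open>s \<le> 2 * (s - 1)\<close>, which is where
    \<open>2 \<le> s\<close> enters.\<close>
  then have m_\<mu>: "m \<le> \<mu>" and \<mu>_m: "\<mu> \<le> 2 * m"
    using s mult_right_mono[of 2 "real s" "cdf P1 t"]
    by (simp_all add: m_def \<mu>_def algebra_simps)
  have min_int: "integrable (obs_law d P0 P1 \<eta>) (\<lambda>x. min (?a x) (?b x))"
  proof (rule obs.integrable_const_bound)
    have "\<bar>min (?a x) (?b x)\<bar> \<le> real d" for x
      using missed_signals_bounds[of d t \<eta> x] false_signals_nonneg[of d t \<eta> x] by linarith
    then show "AE x in obs_law d P0 P1 \<eta>. norm (min (?a x) (?b x)) \<le> real d" by simp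
  qed measurable
  \<comment> \<open>The two variance terms cost at most \<open>(2 * m + m) / 6 = m / 2\<close>; the
    constant 3 in the minorant is matched to this.\<close>
  have "m / 2 - 3 / 2 \<le> m - 3 / 2 - \<mu> / 6 - m / 6"
    using \<mu>_m by simp
  also have "\<dots> \<le> m - 3 / 2 - (\<integral>x. (?a x - \<mu>)\<^sup>2 \<partial>PiM {1..d} M) / 6
      - (\<integral>x. (?b x - m)\<^sup>2 \<partial>PiM {1..d} M) / 6"
    using a_var b_var by simp
  also have "\<dots> = (\<integral>x. m - 3 / 2 - (?a x - \<mu>)\<^sup>2 / 6 - (?b x - m)\<^sup>2 / 6 \<partial>obs_law d P0 P1 \<eta>)"
    using a_int b_int obs.prob_space unfolding obs[symmetric] by simp
  also have "\<dots> \<le> (\<integral>x. min (?a x) (?b x) \<partial>obs_law d P0 P1 \<eta>)"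
    using a_int b_int min_int m_\<mu> unfolding obs[symmetric]
    by (intro integral_mono min_ge_quadratic) simp_all
  finally show ?thesis by (simp add: m_def)
qed

section \<open>Common dominating measure and passage from average to minimax risk\<close>

lemma likelihood_measurable [measurable]:
  assumes [measurable]: "f0 \<in> borel_measurable borel" "f1 \<in> borel_measurable borel"
  shows "likelihood d f0 f1 \<eta> \<in> borel_measurable (PiM {1..d} (\<lambda>_. borel))"
  unfolding likelihood_def by measurable

text \<open>It suffices to compare the measures on boxes, where both the indicator and the
  likelihood factorise over the coordinates. All observation laws thereby share one dominating
  measure.\<close>

lemma obs_law_eq_density:
  assumes P: "prob_space P0" "prob_space P1"
    and f: "is_density_of f0 P0" "is_density_of f1 P1"
  shows "obs_law d P0 P1 \<eta> = density (PiM {1..d} (\<lambda>_. lborel)) (\<lambda>x. ennreal (likelihood d f0 f1 \<eta> x))"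
proof -
  have f_meas [measurable]: "f0 \<in> borel_measurable borel" "f1 \<in> borel_measurable borel"
    and f_nonneg: "\<And>x. 0 \<le> f0 x" "\<And>x. 0 \<le> f1 x"
    using f by (auto simp: is_density_of_def)
  interpret P0: prob_space P0 by fact
  interpret P1: prob_space P1 by fact
  define M where "M j = (if \<eta> j = 1 then P1 else P0)" for j :: nat
  define g where "g j y = (if \<eta> j = 1 then f1 y else f0 y)" for j :: nat and y
  interpret M: product_prob_space M "{1..d}"
    by (rule product_prob_spaceI) (use P in \<open>simp add: M_def\<close>)
  interpret L: product_sigma_finite "\<lambda>_::nat. lborel :: real measure" by standard
  have g_meas [measurable]: "g j \<in> borel_measurable borel" for j by (simp add: g_def[abs_def])
  have g_nonneg: "0 \<le> g j x" for j x using f_nonneg by (simp add: g_def)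
  have M_eq: "M j = density lborel (\<lambda>x. ennreal (g j x))" for j
    using f unfolding M_def g_def is_density_of_def by (cases "\<eta> j = 1") simp_all
  have lik: "ennreal (likelihood d f0 f1 \<eta> x) = (\<Prod>j\<in>{1..d}. ennreal (g j (x j)))" for x
    unfolding likelihood_def g_def[symmetric] using g_nonneg by (rule prod_ennreal[symmetric])
  have meas: "(\<lambda>x. ennreal (likelihood d f0 f1 \<eta> x)) \<in> borel_measurable (PiM {1..d} (\<lambda>_. lborel))"
    unfolding lik by measurable
  have "density (PiM {1..d} (\<lambda>_. lborel)) (\<lambda>x. ennreal (likelihood d f0 f1 \<eta> x)) = PiM {1..d} M"
  proof (rule M.PiM_eqI)
    show "sets (density (PiM {1..d} (\<lambda>_. lborel)) (\<lambda>x. ennreal (likelihood d f0 f1 \<eta> x))) =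
        sets (PiM {1..d} M)"
      unfolding sets_density by (rule sets_PiM_cong) (auto simp: M_eq)
    fix A assume "\<And>j. j \<in> {1..d} \<Longrightarrow> A j \<in> sets (M j)"
    then have A: "\<And>j. j \<in> {1..d} \<Longrightarrow> A j \<in> sets borel" by (simp add: M_eq)
    then have PiE: "PiE {1..d} A \<in> sets (PiM {1..d} (\<lambda>_. lborel))"
      by (intro sets_PiM_I_finite) auto
    have "emeasure (density (PiM {1..d} (\<lambda>_. lborel)) (\<lambda>x. ennreal (likelihood d f0 f1 \<eta> x))) (PiE {1..d} A)
        = (\<integral>\<^sup>+x. ennreal (likelihood d f0 f1 \<eta> x) * indicator (PiE {1..d} A) x \<partial>PiM {1..d} (\<lambda>_. lborel))"
      by (rule emeasure_density[OF meas PiE])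
    also have "\<dots> = (\<integral>\<^sup>+x. (\<Prod>j\<in>{1..d}. ennreal (g j (x j)) * indicator (A j) (x j)) \<partial>PiM {1..d} (\<lambda>_. lborel))"
    proof (rule nn_integral_cong)
      fix x assume "x \<in> space (PiM {1..d} (\<lambda>_. lborel :: real measure))"
      then have "indicator (PiE {1..d} A) x = (\<Prod>j\<in>{1..d}. indicator (A j) (x j) :: ennreal)"
        by (auto simp: indicator_def space_PiM PiE_iff)
      then show "ennreal (likelihood d f0 f1 \<eta> x) * indicator (PiE {1..d} A) x =
          (\<Prod>j\<in>{1..d}. ennreal (g j (x j)) * indicator (A j) (x j))"
        by (simp add: lik prod.distrib)
    qed
    also have "\<dots> = (\<Prod>j\<in>{1..d}. \<integral>\<^sup>+y. ennreal (g j y) * indicator (A j) y \<partial>lborel)"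
      by (rule L.product_nn_integral_prod) (use A in auto)
    also have "\<dots> = (\<Prod>j\<in>{1..d}. emeasure (M j) (A j))"
      by (intro prod.cong refl) (use A in \<open>simp add: M_eq emeasure_density\<close>)
    finally show "emeasure (density (PiM {1..d} (\<lambda>_. lborel)) (\<lambda>x. ennreal (likelihood d f0 f1 \<eta> x))) (PiE {1..d} A)
      = (\<Prod>j\<in>{1..d}. emeasure (M j) (A j))" .
  qed simp
  then show ?thesis by (simp add: obs_law_def M_def[abs_def])
qed

lemma hamming_bounds: "0 \<le> hamming d a b" "hamming d a b \<le> d"
proof -
  show "0 \<le> hamming d a b" unfolding hamming_def by (intro sum_nonneg) simp
  have "hamming d a b \<le> (\<Sum>j = 1..d. 1)" unfolding hamming_def by (intro sum_mono) simp
  then show "hamming d a b \<le> d" by simp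
qed

lemma hamming_selector_measurable:
  assumes \<delta>: "\<delta> \<in> selectors d Z"
  shows "(\<lambda>\<omega>. hamming d (\<delta> \<omega>) \<eta>) \<in> borel_measurable (PiM {1..d} (\<lambda>_. borel) \<Otimes>\<^sub>M Z)"
  unfolding hamming_def
proof (rule borel_measurable_sum)
  fix j assume j: "j \<in> {1..d}"
  note \<delta>' = \<delta>[unfolded selectors_def]
  have "(\<lambda>\<omega>. \<delta> \<omega> j) \<in> (PiM {1..d} (\<lambda>_. borel) \<Otimes>\<^sub>M Z) \<rightarrow>\<^sub>M count_space {0, 1}"
    by (rule measurable_compose[OF \<delta>' measurable_component_singleton[OF j]])
  moreover have "(\<lambda>a. of_bool (a \<noteq> \<eta> j) :: real) \<in> borel_measurable (count_space {0, 1})"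
    by simp
  ultimately show "(\<lambda>\<omega>. of_bool (\<delta> \<omega> j \<noteq> \<eta> j) :: real) \<in> borel_measurable (PiM {1..d} (\<lambda>_. borel) \<Otimes>\<^sub>M Z)"
    by (rule measurable_compose)
qed

text \<open>Written against the dominating measure, the sum over configurations moves inside one
  integral, and the inequality at a fixed observation applies with \<open>b\<close> equal to
  \<open>\<delta> \<omega>\<close>.\<close>

lemma sum_hamming_risk_ge:
  assumes P: "prob_space P0" "prob_space P1" and Z: "prob_space Z"
    and f: "is_density_of f0 P0" "is_density_of f1 P1"
    and mlr: "monotone_likelihood_ratio f0 f1"
    and \<delta>: "\<delta> \<in> selectors d Z"
  shows "(\<Sum>\<eta>\<in>configurations d s.
      \<integral>x. min (missed_signals d t \<eta> x) (false_signals d t \<eta> x) \<partial>obs_law d P0 P1 \<eta>)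
    \<le> (\<Sum>\<eta>\<in>configurations d s. hamming_risk d P0 P1 Z \<delta> \<eta>)"
proof -
  interpret Z: prob_space Z by fact
  have f_meas [measurable]: "f0 \<in> borel_measurable borel" "f1 \<in> borel_measurable borel"
    and f_nonneg: "\<And>x. 0 \<le> f0 x" "\<And>x. 0 \<le> f1 x"
    using f by (auto simp: is_density_of_def)
  let ?L = "PiM {1..d} (\<lambda>_. lborel) :: (nat \<Rightarrow> real) measure"
  let ?B = "PiM {1..d} (\<lambda>_. borel) :: (nat \<Rightarrow> real) measure"
  let ?w = "\<lambda>\<eta> \<omega>. likelihood d f0 f1 \<eta> (fst \<omega>)"
  let ?m = "\<lambda>\<eta> x. min (missed_signals d t \<eta> x) (false_signals d t \<eta> x)"
  have sets_L [measurable_cong]: "sets ?L = sets ?B" by (rule sets_PiM_cong) auto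
  note h_meas [measurable] = hamming_selector_measurable[OF \<delta>]
  have obs_sets [measurable_cong]: "sets (obs_law d P0 P1 \<eta>) = sets ?B" for \<eta>
    by (rule sets_obs_law) (use f is_density_of_sets in auto)
  have prob: "prob_space (obs_law d P0 P1 \<eta> \<Otimes>\<^sub>M Z)" for \<eta>
    by (intro prob_space_pair prob_space_obs_law P Z)
  have w_nonneg: "0 \<le> ?w \<eta> \<omega>" for \<eta> and \<omega> :: "(nat \<Rightarrow> real) \<times> 'a"
    by (rule likelihood_nonneg[OF f_nonneg])
  have lik_meas [measurable]: "(\<lambda>x. ennreal (likelihood d f0 f1 \<eta> x)) \<in> borel_measurable ?L" for \<eta>
    by measurable
  \<comment> \<open>The likelihood does not involve the randomisation variable, so \<open>Z\<close>
    enters with density 1.\<close>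
  have law: "obs_law d P0 P1 \<eta> \<Otimes>\<^sub>M Z = density (?L \<Otimes>\<^sub>M Z) (\<lambda>\<omega>. ennreal (?w \<eta> \<omega>))" for \<eta>
  proof -
    have "density ?L (\<lambda>x. ennreal (likelihood d f0 f1 \<eta> x)) \<Otimes>\<^sub>M density Z (\<lambda>_. 1) =
        density (?L \<Otimes>\<^sub>M Z) (\<lambda>(x, z). ennreal (likelihood d f0 f1 \<eta> x) * 1)"
      by (rule pair_measure_density)
         (use lik_meas in \<open>auto simp: density_1 Z.sigma_finite_measure_axioms\<close>)
    then show ?thesis
      by (simp add: obs_law_eq_density[OF P f] density_1 case_prod_unfold)
  qed
  \<comment> \<open>Boundedness gives integrability under the probability law; this is carried over
    to the weighted integrand, as the dominating measure itself is not finite in general.\<close>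
  have transfer: "integrable (?L \<Otimes>\<^sub>M Z) (\<lambda>\<omega>. ?w \<eta> \<omega> * h \<omega>)"
    "(\<integral>\<omega>. h \<omega> \<partial>(obs_law d P0 P1 \<eta> \<Otimes>\<^sub>M Z)) = (\<integral>\<omega>. ?w \<eta> \<omega> * h \<omega> \<partial>(?L \<Otimes>\<^sub>M Z))"
    if h [measurable]: "h \<in> borel_measurable (?B \<Otimes>\<^sub>M Z)" and bd: "\<And>\<omega>. \<bar>h \<omega>\<bar> \<le> real d" for h \<eta>
  proof -
    interpret prob_space "obs_law d P0 P1 \<eta> \<Otimes>\<^sub>M Z" by (rule prob)
    have h_meas': "h \<in> borel_measurable (?L \<Otimes>\<^sub>M Z)" by measurable
    have w_meas: "?w \<eta> \<in> borel_measurable (?L \<Otimes>\<^sub>M Z)" by measurable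
    have "integrable (obs_law d P0 P1 \<eta> \<Otimes>\<^sub>M Z) h"
      by (rule integrable_const_bound[where B = d]) (use bd in auto)
    then show "integrable (?L \<Otimes>\<^sub>M Z) (\<lambda>\<omega>. ?w \<eta> \<omega> * h \<omega>)"
      unfolding law using w_nonneg by (subst (asm) integrable_real_density[OF w_meas _ h_meas']) auto
    show "(\<integral>\<omega>. h \<omega> \<partial>(obs_law d P0 P1 \<eta> \<Otimes>\<^sub>M Z)) = (\<integral>\<omega>. ?w \<eta> \<omega> * h \<omega> \<partial>(?L \<Otimes>\<^sub>M Z))"
      unfolding law using w_nonneg by (intro integral_real_density h_meas' w_meas) auto
  qed
  have m_meas: "(\<lambda>\<omega>. ?m \<eta> (fst \<omega>)) \<in> borel_measurable (?B \<Otimes>\<^sub>M Z)" for \<eta>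
    by measurable
  have m_bd: "\<bar>?m \<eta> x\<bar> \<le> real d" for \<eta> x
    using missed_signals_bounds[of d t \<eta> x] false_signals_nonneg[of d t \<eta> x] by linarith
  have h_bd: "\<bar>hamming d a \<eta>\<bar> \<le> real d" for a \<eta>
    using hamming_bounds[of d a \<eta>] by simp
  note m_transfer = transfer[OF m_meas m_bd] and h_transfer = transfer[OF h_meas h_bd]
  \<comment> \<open>The error counts ignore the randomisation, and the first marginal of the product
    with \<open>Z\<close> is the observation law.\<close>
  have m_eq: "(\<integral>x. ?m \<eta> x \<partial>obs_law d P0 P1 \<eta>) = (\<integral>\<omega>. ?w \<eta> \<omega> * ?m \<eta> (fst \<omega>) \<partial>(?L \<Otimes>\<^sub>M Z))" for \<eta>
  proof -
    have "(\<integral>x. ?m \<eta> x \<partial>obs_law d P0 P1 \<eta>) =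
        (\<integral>x. ?m \<eta> x \<partial>distr (obs_law d P0 P1 \<eta> \<Otimes>\<^sub>M Z) (obs_law d P0 P1 \<eta>) fst)"
      by (simp add: Z.distr_pair_fst)
    also have "\<dots> = (\<integral>\<omega>. ?m \<eta> (fst \<omega>) \<partial>(obs_law d P0 P1 \<eta> \<Otimes>\<^sub>M Z))"
      by (rule integral_distr) measurable
    finally show ?thesis using m_transfer(2) by simp
  qed
  have "(\<Sum>\<eta>\<in>configurations d s. \<integral>x. ?m \<eta> x \<partial>obs_law d P0 P1 \<eta>) =
      (\<integral>\<omega>. (\<Sum>\<eta>\<in>configurations d s. ?w \<eta> \<omega> * ?m \<eta> (fst \<omega>)) \<partial>(?L \<Otimes>\<^sub>M Z))"
    unfolding m_eq by (rule Bochner_Integration.integral_sum[symmetric]) (rule m_transfer)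
  also have "\<dots> \<le> (\<integral>\<omega>. (\<Sum>\<eta>\<in>configurations d s. ?w \<eta> \<omega> * hamming d (\<delta> \<omega>) \<eta>) \<partial>(?L \<Otimes>\<^sub>M Z))"
    by (intro integral_mono Bochner_Integration.integrable_sum m_transfer h_transfer
        weighted_hamming_ge[OF mlr f_nonneg])
  also have "\<dots> = (\<Sum>\<eta>\<in>configurations d s. \<integral>\<omega>. ?w \<eta> \<omega> * hamming d (\<delta> \<omega>) \<eta> \<partial>(?L \<Otimes>\<^sub>M Z))"
    by (rule Bochner_Integration.integral_sum) (rule h_transfer)
  also have "\<dots> = (\<Sum>\<eta>\<in>configurations d s. hamming_risk d P0 P1 Z \<delta> \<eta>)"
    unfolding hamming_risk_def by (simp add: h_transfer(2))
  finally show ?thesis .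
qed

text \<open>For every selector the largest risk is at least the average risk over the
  configurations, and the latter has a bound free of the selector.\<close>

lemma minimax_risk_ge:
  assumes P: "prob_space P0" "prob_space P1" and Z: "prob_space Z"
    and f: "is_density_of f0 P0" "is_density_of f1 P1"
    and mlr: "monotone_likelihood_ratio f0 f1"
    and s: "2 \<le> s" "s \<le> d"
    and balance: "(real s - 1) * cdf P1 t = (real d - real s) * (1 - cdf P0 t)"
  shows "(real s - 1) * cdf P1 t / 2 - 3 / 2 \<le> minimax_risk d s P0 P1 Z"
  unfolding minimax_risk_def configurations_def[symmetric]
proof (rule cINF_greatest)
  let ?H = "configurations d s" and ?c = "(real s - 1) * cdf P1 t / 2 - 3 / 2"
  \<comment> \<open>The constant zero selector makes the index set of the real infimum
    nonempty.\<close>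
  have "(\<lambda>_. \<lambda>j\<in>{1..d}. 0) \<in> selectors d Z"
    unfolding selectors_def by (intro measurable_restrict) simp
  then show "selectors d Z \<noteq> {}" by blast
  fix \<delta> assume \<delta>: "\<delta> \<in> selectors d Z"
  let ?R = "hamming_risk d P0 P1 Z \<delta>"
  have "real (card ?H) * ?c \<le> (\<Sum>\<eta>\<in>?H.
      \<integral>x. min (missed_signals d t \<eta> x) (false_signals d t \<eta> x) \<partial>obs_law d P0 P1 \<eta>)"
    by (rule sum_bounded_below)
       (intro expectation_min_ge P f[THEN is_density_of_sets] s balance)
  also have "\<dots> \<le> (\<Sum>\<eta>\<in>?H. ?R \<eta>)"
    by (rule sum_hamming_risk_ge[OF P Z f mlr \<delta>])
  also have "\<dots> \<le> real (card ?H) * (SUP \<eta>\<in>?H. ?R \<eta>)"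
    by (rule sum_bounded_above) (intro cSUP_upper bdd_above_finite finite_imageI finite_configurations)
  finally show "?c \<le> (SUP \<eta>\<in>?H. ?R \<eta>)"
    using finite_configurations configurations_nonempty[OF s(2)] by (simp add: card_gt_0_iff)
qed

section \<open>The threshold functional\<close>

lemma is_density_of_measure_singleton:
  assumes "is_density_of f P" shows "measure P {x} = 0"
proof -
  have "emeasure P {x} = 0"
    using assms unfolding is_density_of_def
    by (auto simp: emeasure_density nn_integral_null_set)
  then show ?thesis by (simp add: measure_def)
qed

lemma is_density_of_AE_nonzero: "is_density_of f P \<Longrightarrow> AE x in P. f x \<noteq> 0"
  by (auto simp: is_density_of_def AE_density)

lemma is_density_of_real_distribution:
  assumes "prob_space P" "is_density_of f P" shows "real_distribution P"
  using assms by (auto simp: real_distribution_def real_distribution_axioms_def is_density_of_def)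

lemma is_density_of_isCont_cdf:
  assumes "prob_space P" "is_density_of f P" shows "isCont (cdf P) x"
proof -
  interpret real_distribution P using is_density_of_real_distribution assms .
  show ?thesis using is_density_of_measure_singleton[OF assms(2)] by (simp add: isCont_cdf)
qed

text \<open>The difference of the two sides is continuous, tends to \<open>- b\<close> at minus
  infinity and to \<open>a\<close> at plus infinity, so the intermediate value theorem gives a
  zero.\<close>

lemma balance_point_exists:
  assumes P: "prob_space P0" "prob_space P1" and f: "is_density_of f0 P0" "is_density_of f1 P1"
    and "0 < a" "0 < b"
  shows "\<exists>t. a * cdf P1 t = b * (1 - cdf P0 t)"
proof -
  interpret P0: real_distribution P0 using is_density_of_real_distribution P f by blast
  interpret P1: real_distribution P1 using is_density_of_real_distribution P f by blast
  define h where "h t = a * cdf P1 t - b * (1 - cdf P0 t)" for t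
  have "(h \<longlongrightarrow> a * 1 - b * (1 - 1)) at_top"
    unfolding h_def by (intro tendsto_intros P0.cdf_lim_at_top_prob P1.cdf_lim_at_top_prob)
  then have "\<forall>\<^sub>F t in at_top. 0 < h t"
    by (rule order_tendstoD) (use \<open>0 < a\<close> in simp)
  then obtain v where v: "\<And>t. v \<le> t \<Longrightarrow> 0 < h t" by (auto simp: eventually_at_top_linorder)
  have "(h \<longlongrightarrow> a * 0 - b * (1 - 0)) at_bot"
    unfolding h_def by (intro tendsto_intros P0.cdf_lim_at_bot P1.cdf_lim_at_bot)
  then have "\<forall>\<^sub>F t in at_bot. h t < 0"
    by (rule order_tendstoD) (use \<open>0 < b\<close> in simp)
  then obtain u where u: "\<And>t. t \<le> u \<Longrightarrow> h t < 0" by (auto simp: eventually_at_bot_linorder)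
  have "isCont h t" for t
    unfolding h_def by (intro continuous_intros is_density_of_isCont_cdf[OF P(1) f(1)] is_density_of_isCont_cdf[OF P(2) f(2)])
  \<comment> \<open>The points \<open>u\<close> and \<open>v\<close> come without an order; the left
    endpoint \<open>min u v\<close> still lies where \<open>h\<close> is negative.\<close>
  then have "\<exists>t\<ge>min u v. t \<le> v \<and> h t = 0"
    by (intro IVT) (use u[of "min u v"] v[of v] in \<open>auto simp: less_imp_le\<close>)
  then show ?thesis by (auto simp: h_def)
qed

text \<open>The pointwise inequality is integrated over \<open>A\<close>, in extended nonnegative
  reals so that no integrability has to be discussed.\<close>

lemma is_density_of_scaled_measure_le:
  assumes P: "prob_space P" "prob_space Q" and f: "is_density_of f P" "is_density_of g Q"
    and A [measurable]: "A \<in> sets borel" and "0 \<le> a" "0 \<le> b" and le: "\<And>x. x \<in> A \<Longrightarrow> a * f x \<le> b * g x"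
  shows "a * measure P A \<le> b * measure Q A"
proof -
  interpret P: prob_space P by fact
  interpret Q: prob_space Q by fact
  have [measurable]: "f \<in> borel_measurable borel" "g \<in> borel_measurable borel"
    and nonneg: "\<And>x. 0 \<le> f x" "\<And>x. 0 \<le> g x"
    using f by (auto simp: is_density_of_def)
  have emeasure_scaled: "ennreal (c * measure R A) = (\<integral>\<^sup>+x. ennreal (c * h x) * indicator A x \<partial>lborel)"
    if "is_density_of h R" "prob_space R" "0 \<le> c" for c h R
  proof -
    interpret R: prob_space R by fact
    have [measurable]: "h \<in> borel_measurable borel" and "\<And>x. 0 \<le> h x"
      using that(1) by (auto simp: is_density_of_def)
    have "ennreal (c * measure R A) = ennreal c * emeasure R A"
      using that(3) by (simp add: ennreal_mult R.emeasure_eq_measure)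
    also have "emeasure R A = (\<integral>\<^sup>+x. ennreal (h x) * indicator A x \<partial>lborel)"
      using that(1) A unfolding is_density_of_def by (auto simp: emeasure_density)
    also have "ennreal c * \<dots> = (\<integral>\<^sup>+x. ennreal c * (ennreal (h x) * indicator A x) \<partial>lborel)"
      using A by (intro nn_integral_cmult[symmetric]) measurable
    finally show ?thesis
      using that(3) \<open>\<And>x. 0 \<le> h x\<close> by (simp add: ennreal_mult mult.assoc)
  qed
  have "ennreal (a * measure P A) \<le> ennreal (b * measure Q A)"
    unfolding emeasure_scaled[OF f(1) P(1) \<open>0 \<le> a\<close>] emeasure_scaled[OF f(2) P(2) \<open>0 \<le> b\<close>]
    by (intro nn_integral_mono) (auto simp: indicator_def le intro!: ennreal_leI)
  then show ?thesis using \<open>0 \<le> b\<close> by (simp add: ennreal_le_iff)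
qed

lemma cdf_diff_measure:
  assumes "real_distribution P" "x \<le> y"
  shows "cdf P y - cdf P x = measure P {x<..y}"
proof -
  interpret real_distribution P by fact
  show ?thesis
    using cdf_diff_eq[of x y] \<open>x \<le> y\<close> by (cases "x = y") auto
qed

text \<open>\<open>(s - 1) f\<^sub>1 - (d - s) f\<^sub>0\<close>, the derivative of \<open>\<Psi>\<close>, changes sign from negative to positive at \<open>t\<^sub>2\<close>.\<close>
lemma Psi_ge_at_stationary:
  assumes P: "prob_space P0" "prob_space P1" and f: "is_density_of f0 P0" "is_density_of f1 P1"
    and mlr: "monotone_likelihood_ratio f0 f1"
    and s: "1 \<le> s" "s \<le> d" and u: "u \<in> support_on UNIV f0"
    and stat: "(real s - 1) * f1 u = (real d - real s) * f0 u"
  shows "Psi d s P0 P1 u \<le> Psi d s P0 P1 t"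
proof -
  let ?a = "real s - 1" and ?b = "real d - real s"
  have nonneg: "\<And>x. 0 \<le> f0 x" "\<And>x. 0 \<le> f1 x" using f by (auto simp: is_density_of_def)
  have f0u: "0 < f0 u" using u nonneg by (simp add: in_support_on order_less_le)
  note cross = monotone_likelihood_ratio_cross[OF mlr nonneg]
  have ab: "0 \<le> ?a" "0 \<le> ?b" using s by auto
  \<comment> \<open>Stationarity at \<open>u\<close> turns the cross-multiplied ratio inequality
    between \<open>u\<close> and \<open>x\<close> into the desired one times the positive factor
    \<open>f0 u\<close>.\<close>
  have scaled: "?a * (f1 u * f0 x) = (?b * f0 x) * f0 u" for x
    using stat by (metis (no_types, lifting) mult.assoc mult.commute)
  have above: "?b * f0 x \<le> ?a * f1 x" if "u < x" for x
  proof -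
    have "(?b * f0 x) * f0 u \<le> (?a * f1 x) * f0 u"
      using mult_left_mono[OF cross[OF that] ab(1)] scaled[of x] by (simp add: mult.assoc)
    then show ?thesis using f0u by simp
  qed
  have below: "?a * f1 x \<le> ?b * f0 x" if "x \<le> u" for x
  proof (cases "x = u")
    case False
    have "(?a * f1 x) * f0 u \<le> (?b * f0 x) * f0 u"
      using mult_left_mono[OF cross[of x u] ab(1)] scaled[of x] that False by (simp add: mult.assoc)
    then show ?thesis using f0u by simp
  qed (use stat in simp)
  have dist: "real_distribution P0" "real_distribution P1"
    using is_density_of_real_distribution P f by blast+
  show ?thesis
  \<comment> \<open>On either side of \<open>u\<close>, the increment of \<open>Psi\<close> is
    \<open>?a\<close> times the \<open>P1\<close> mass minus \<open>?b\<close> times the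
    \<open>P0\<close> mass of the interval between \<open>u\<close> and \<open>t\<close>, up to
    orientation.\<close>
  proof (cases "u \<le> t")
    case True
    have "?b * measure P0 {u<..t} \<le> ?a * measure P1 {u<..t}"
      by (rule is_density_of_scaled_measure_le[OF P f]) (use ab above in auto)
    then show ?thesis
      using cdf_diff_measure[OF dist(1) True, symmetric] cdf_diff_measure[OF dist(2) True, symmetric]
      by (simp add: Psi_def algebra_simps)
  next
    case False
    then have tu: "t \<le> u" by simp
    have "?a * measure P1 {t<..u} \<le> ?b * measure P0 {t<..u}"
      by (rule is_density_of_scaled_measure_le[OF P(2,1) f(2,1)]) (use ab below in auto)
    then show ?thesis
      using cdf_diff_measure[OF dist(1) tu, symmetric] cdf_diff_measure[OF dist(2) tu, symmetric]
      by (simp add: Psi_def algebra_simps)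
  qed
qed

text \<open>At a stationary point the likelihood ratio equals the threshold \<open>?b / ?a\<close>,
  so on the support the likelihood ratio test is the comparison of \<open>x\<close> with
  \<open>u\<close>. The events differ only by null sets.\<close>

lemma Psi_eq_Psi_sep:
  assumes P: "prob_space P0" "prob_space P1" and f: "is_density_of f0 P0" "is_density_of f1 P1"
    and mlr: "monotone_likelihood_ratio f0 f1"
    and s: "2 \<le> s" "s < d" and u: "u \<in> support_on UNIV f0"
    and stat: "(real s - 1) * f1 u = (real d - real s) * f0 u"
  shows "Psi d s P0 P1 u = Psi_sep f0 f1 P0 P1 (d - 1) (s - 1)"
proof -
  interpret P0: real_distribution P0 using is_density_of_real_distribution P f by blast
  interpret P1: real_distribution P1 using is_density_of_real_distribution P f by blast
  let ?a = "real s - 1" and ?b = "real d - real s"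
  have [measurable]: "f0 \<in> borel_measurable borel" "f1 \<in> borel_measurable borel"
    and nonneg: "\<And>x. 0 \<le> f0 x" "\<And>x. 0 \<le> f1 x" using f by (auto simp: is_density_of_def)
  have supp: "f0 x = 0 \<longleftrightarrow> f1 x = 0" for x
    using mlr by (auto simp: monotone_likelihood_ratio_def support_on_def)
  have a: "0 < ?a" and b: "0 < ?b" using s by auto
  have ratio_u: "f1 u / f0 u = ?b / ?a"
    using stat a u by (simp add: in_support_on field_simps)
  have sign: "?a * f1 x < ?b * f0 x \<longleftrightarrow> x < u" if "f0 x \<noteq> 0" for x
  proof -
    have "0 < f0 x" using that nonneg by (simp add: order_less_le)
    then have "?a * f1 x < ?b * f0 x \<longleftrightarrow> f1 x / f0 x < f1 u / f0 u"
      unfolding ratio_u using a by (simp add: field_simps)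
    also have "\<dots> \<longleftrightarrow> x < u"
      using mlr that u unfolding monotone_likelihood_ratio_def
      by (metis (mono_tags, lifting) UNIV_I in_support_on strict_mono_on_less)
    finally show ?thesis .
  qed
  have AE_supp: "AE x in P0. f0 x \<noteq> 0" "AE x in P1. f0 x \<noteq> 0"
    using f[THEN is_density_of_AE_nonzero] by (simp_all add: supp)
  have AE_ne: "AE x in P0. x \<noteq> u" "AE x in P1. x \<noteq> u"
    using f AE_lborel_singleton[of u] by (auto simp: is_density_of_def AE_density)
  \<comment> \<open>The test event is \<open>x < u\<close> on the support, while the cdf uses
    \<open>{..u}\<close>; the point \<open>u\<close> and the complement of the support are
    null.\<close>
  have "measure P1 {x. ?a * f1 x < ?b * f0 x} = measure P1 {..u}"
    by (rule P1.finite_measure_eq_AE, use AE_supp(2) AE_ne(2) in eventually_elim)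
       (auto simp: sign)
  moreover have "measure P0 {x. ?b * f0 x \<le> ?a * f1 x} = measure P0 {u<..}"
    by (rule P0.finite_measure_eq_AE, use AE_supp(1) AE_ne(1) in eventually_elim)
       (auto simp: sign not_less[symmetric])
  moreover have "measure P0 {u<..} = 1 - cdf P0 u"
    using P0.prob_compl[of "{..u}"] by (simp add: cdf_def Compl_eq_Diff_UNIV[symmetric])
  moreover have "real (d - 1) - real (s - 1) = ?b" "real (s - 1) = ?a" using s by auto
  ultimately show ?thesis by (simp add: Psi_def Psi_sep_def cdf_def)
qed

theorem theorem8:
  fixes d s :: nat
    and f0 f1 :: "real \<Rightarrow> real"
    and P0 P1 :: "real measure"
    and Z :: "'z measure"
    and t2 :: real
  assumes "d > 2" and "s < d"
    and "2 \<le> s" and "real s \<le> (real d + 2) / 3"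
    and "prob_space P0" and "prob_space P1" and "P0 \<noteq> P1"
    and "is_density_of f0 P0" and "is_density_of f1 P1"
    and "monotone_likelihood_ratio f0 f1"
    and "prob_space Z"
    and "t2 \<in> support_on UNIV f0"
    and "(real s - 1) * f1 t2 = (real d - real s) * f0 t2"
  shows "(\<exists>t1. (real s - 1) * cdf P1 t1 = (real d - real s) * (1 - cdf P0 t1)) \<and>
    (\<forall>t1. (real s - 1) * cdf P1 t1 = (real d - real s) * (1 - cdf P0 t1) \<longrightarrow>
       Psi d s P0 P1 t1 \<ge> 24 \<longrightarrow>
         minimax_risk d s P0 P1 Z \<ge> 1 / 20 * Psi d s P0 P1 t1 \<and>
         1 / 20 * Psi d s P0 P1 t1 \<ge> 1 / 20 * Psi d s P0 P1 t2 \<and>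
         1 / 20 * Psi d s P0 P1 t2 = 1 / 20 * Psi_sep f0 f1 P0 P1 (d - 1) (s - 1))"
proof (intro conjI allI impI)
  note P = \<open>prob_space P0\<close> \<open>prob_space P1\<close> and f = \<open>is_density_of f0 P0\<close> \<open>is_density_of f1 P1\<close>
  show "\<exists>t1. (real s - 1) * cdf P1 t1 = (real d - real s) * (1 - cdf P0 t1)"
    by (rule balance_point_exists[OF P f]) (use assms in auto)
  fix t1
  assume balance: "(real s - 1) * cdf P1 t1 = (real d - real s) * (1 - cdf P0 t1)"
    and large: "24 \<le> Psi d s P0 P1 t1"
  \<comment> \<open>Both summands of \<open>Psi\<close> agree at a balance point, so the risk bound
    reads \<open>Psi / 4 - 3 / 2\<close>. This is at least \<open>Psi / 20\<close>, as
    \<open>Psi / 5\<close> is at least \<open>24 / 5\<close>.\<close>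
  have "Psi d s P0 P1 t1 = 2 * ((real s - 1) * cdf P1 t1)"
    using balance by (simp add: Psi_def)
  moreover have "(real s - 1) * cdf P1 t1 / 2 - 3 / 2 \<le> minimax_risk d s P0 P1 Z"
    by (rule minimax_risk_ge[OF P \<open>prob_space Z\<close> f]) (use assms balance in auto)
  ultimately show "1 / 20 * Psi d s P0 P1 t1 \<le> minimax_risk d s P0 P1 Z"
    using large by linarith
  show "1 / 20 * Psi d s P0 P1 t2 \<le> 1 / 20 * Psi d s P0 P1 t1"
    using Psi_ge_at_stationary[OF P f, of s d t2 t1] assms by simp
  show "1 / 20 * Psi d s P0 P1 t2 = 1 / 20 * Psi_sep f0 f1 P0 P1 (d - 1) (s - 1)"
    using Psi_eq_Psi_sep[OF P f, of s d t2] assms by simp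
qed

end
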